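(* Let $(\Omega,\mu)$ be a complete $\sigma$-finite measure space and let $\Phi_1,\Phi_2,\Phi_3$ be Young functions. Suppose there exist positive constants $C_1,C_2$ such that, for all $u\in(0,\infty)$, $$C_1^{-1}\Phi_2^{-1}(u)\le\Phi_1^{-1}(u)\,\Phi_3^{-1}(u)\le C_2\,\Phi_2^{-1}(u).$$ Then $$\mathrm{PWM}(\mathrm{w}L^{\Phi_1}(\Omega),\mathrm{w}L^{\Phi_2}(\Omega))=\mathrm{w}L^{\Phi_3}(\Omega),$$ and, for all $g$ in this space, $$C_1^{-1}\|g\|_{\mathrm{w}L^{\Phi_3}(\Omega)}\le\|g\|_{\mathrm{PWM}(\mathrm{w}L^{\Phi_1}(\Omega),\mathrm{w}L^{\Phi_2}(\Omega))}\le 4C_2\,\|g\|_{\mathrm{w}L^{\Phi_3}(\Omega)}.$$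
   Context: $L^0(\Omega)$ is the set of all measurable functions from $\Omega$ to $\mathbb{R}$ or $\mathbb{C}$ (functions equal a.e. are identified). The convention $0\cdot\infty=0$ is used. Young functions. "Increasing" means nondecreasing. For an increasing function $\Phi:[0,\infty]\to[0,\infty]$ let $a(\Phi)=\sup\{t\ge0:\Phi(t)=0\}$ and $b(\Phi)=\inf\{t\ge0:\Phi(t)=\infty\}$, with $\sup\emptyset=0$, $\inf\emptyset=\infty$. $\Phi$ is a Young function if: $0\le a(\Phi)<\infty$ and $0<b(\Phi)\le\infty$; $\lim_{t\to+0}\Phi(t)=\Phi(0)=0$; $\Phi$ is convex on $[0,b(\Phi))$; if $b(\Phi)=\infty$ then $\lim_{t\to\infty}\Phi(t)=\Phi(\infty)=\infty$; if $b(\Phi)<\infty$ then $\lim_{t\to b(\Phi)-0}\Phi(t)=\Phi(b(\Phi))\ (\le\infty)$. Generalized inverse: $\Phi^{-1}(u)=\inf\{t\ge0:\Phi(t)>u\}$ for $u\in[0,\infty)$, and $\Phi^{-1}(\infty)=\infty$. Weak Orlicz space: for $f\in L^0(\Omega)$ and $t\ge 0$ let $\mu(f,t)=\mu(\{x\in\Omega:|f(x)|>t\})$. Then $$\mathrm{w}L^{\Phi}(\Omega)=\Big\{f\in L^0(\Omega):\sup_{t\in(0,\infty)}\Phi(t)\,\mu(\epsilon f,t)<\infty\text{ for some }\epsilon>0\Big\},$$ $$\|f\|_{\mathrm{w}L^{\Phi}(\Omega)}=\inf\Big\{\lambda>0:\sup_{t\in(0,\infty)}\Phi(t)\,\mu(f/\lambda,t)\le1\Big\},$$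 which is a quasi-norm; $\mathrm{w}L^{\Phi}(\Omega)$ is a complete quasi-normed space. Pointwise multipliers: for subspaces $E_1,E_2\subset L^0(\Omega)$, $\mathrm{PWM}(E_1,E_2)$ is the set of all $g\in L^0(\Omega)$ such that $fg\in E_2$ for every $f\in E_1$. When $E_1,E_2$ are quasi-normed, $\|g\|_{\mathrm{PWM}(E_1,E_2)}$ denotes the operator norm of $f\mapsto fg$, i.e. the infimum of the $K\ge0$ such that $\|fg\|_{E_2}\le K\|f\|_{E_1}$ for all $f\in E_1$. It is a known fact that for complete quasi-normed spaces $E_1,E_2\subset L^0(\Omega)$ with the lattice property ($f\in E$, $h\in L^0(\Omega)$, $|h|\le|f|$ a.e. imply $h\in E$ and $\|h\|_E\le\|f\|_E$), in particular for weak Orlicz spaces, every $g\in\mathrm{PWM}(E_1,E_2)$ defines a bounded operator, so this operator norm is finite. *)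

theory Defs
  imports "HOL-Analysis.Analysis"
begin

text \<open>
  The value set \<open>[0,\<infinity>]\<close> is \<^typ>\<open>ennreal\<close>, whose multiplication satisfies \<open>0 * \<infinity> = 0\<close>,
  and in which the supremum (infimum) of the empty set is \<open>0\<close> (\<open>\<infinity>\<close>).
\<close>

definition young_a :: "(ennreal \<Rightarrow> ennreal) \<Rightarrow> ennreal" where
  "young_a \<Phi> = Sup {t. \<Phi> t = 0}"

definition young_b :: "(ennreal \<Rightarrow> ennreal) \<Rightarrow> ennreal" where
  "young_b \<Phi> = Inf {t. \<Phi> t = \<infinity>}"

text \<open>
  The limit \<open>t \<rightarrow> \<infinity>\<close> through finite \<open>t\<close> is taken along the filter \<open>at_left \<infinity>\<close>: since
  \<^typ>\<open>ennreal\<close> has a greatest element, \<open>at_top\<close> would only inspect the value at \<open>\<infinity>\<close>.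
\<close>

definition young_function :: "(ennreal \<Rightarrow> ennreal) \<Rightarrow> bool" where
  "young_function \<Phi> \<longleftrightarrow>
     mono \<Phi> \<and>
     young_a \<Phi> < \<infinity> \<and> 0 < young_b \<Phi> \<and>
     \<Phi> 0 = 0 \<and> (\<Phi> \<longlongrightarrow> 0) (at_right 0) \<and>
     (\<forall>x y. \<forall>s::real. x < young_b \<Phi> \<longrightarrow> y < young_b \<Phi> \<longrightarrow> 0 \<le> s \<longrightarrow> s \<le> 1 \<longrightarrow>
        \<Phi> (ennreal (1 - s) * x + ennreal s * y) \<le> ennreal (1 - s) * \<Phi> x + ennreal s * \<Phi> y) \<and>
     (young_b \<Phi> = \<infinity> \<longrightarrow> \<Phi> \<infinity> = \<infinity> \<and> (\<Phi> \<longlongrightarrow> \<infinity>) (at_left \<infinity>)) \<and>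
     (young_b \<Phi> < \<infinity> \<longrightarrow> (\<Phi> \<longlongrightarrow> \<Phi> (young_b \<Phi>)) (at_left (young_b \<Phi>)))"

definition young_inverse :: "(ennreal \<Rightarrow> ennreal) \<Rightarrow> ennreal \<Rightarrow> ennreal" where
  "young_inverse \<Phi> u = (if u = \<infinity> then \<infinity> else Inf {t. \<Phi> t > u})"

text \<open>
  Elements of \<open>L\<^sup>0\<close> are represented by Borel measurable functions, without passing to the
  quotient by a.e. equality: all the function sets below contain, with a function, every
  measurable function a.e. equal to it, and the (quasi-)norms do not depend on the representative.
\<close>

definition distr_fun :: "'x measure \<Rightarrow> ('x \<Rightarrow> 'a::real_normed_field) \<Rightarrow> ennreal \<Rightarrow> ennreal" where
  "distr_fun M f t = emeasure M {x \<in> space M. ennreal (norm (f x)) > t}"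

definition weak_orlicz ::
    "'x measure \<Rightarrow> (ennreal \<Rightarrow> ennreal) \<Rightarrow> ('x \<Rightarrow> 'a::real_normed_field) set" where
  "weak_orlicz M \<Phi> = {f \<in> borel_measurable M.
     \<exists>\<epsilon>::real. \<epsilon> > 0 \<and> (SUP t\<in>{0<..<\<infinity>}. \<Phi> t * distr_fun M (\<lambda>x. of_real \<epsilon> * f x) t) < \<infinity>}"

definition weak_orlicz_norm ::
    "'x measure \<Rightarrow> (ennreal \<Rightarrow> ennreal) \<Rightarrow> ('x \<Rightarrow> 'a::real_normed_field) \<Rightarrow> ennreal" where
  "weak_orlicz_norm M \<Phi> f = (INF r\<in>{r::real. r > 0 \<and>
     (SUP t\<in>{0<..<\<infinity>}. \<Phi> t * distr_fun M (\<lambda>x. f x / of_real r) t) \<le> 1}. ennreal r)"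

definition PWM ::
    "'x measure \<Rightarrow> ('x \<Rightarrow> 'a::real_normed_field) set \<Rightarrow> ('x \<Rightarrow> 'a) set \<Rightarrow> ('x \<Rightarrow> 'a) set" where
  "PWM M E1 E2 = {g \<in> borel_measurable M. \<forall>f\<in>E1. (\<lambda>x. f x * g x) \<in> E2}"

text \<open>
  Operator norm of \<open>f \<mapsto> f g\<close> from the space \<open>E1\<close> with quasi-norm \<open>N1\<close> to a space with
  quasi-norm \<open>N2\<close>; it is \<open>\<infinity>\<close> precisely when the operator is unbounded.
\<close>

definition PWM_norm ::
    "('x \<Rightarrow> 'a::real_normed_field) set \<Rightarrow> (('x \<Rightarrow> 'a) \<Rightarrow> ennreal) \<Rightarrow> (('x \<Rightarrow> 'a) \<Rightarrow> ennreal)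
      \<Rightarrow> ('x \<Rightarrow> 'a) \<Rightarrow> ennreal" where
  "PWM_norm E1 N1 N2 g =
     (INF K\<in>{K::real. K \<ge> 0 \<and> (\<forall>f\<in>E1. N2 (\<lambda>x. f x * g x) \<le> ennreal K * N1 f)}. ennreal K)"

text \<open>
  Scalar fields will have sort \<open>{real_normed_field, euclidean_space}\<close>. It has the instances
  \<^typ>\<open>real\<close> and \<^typ>\<open>complex\<close>, and by Frobenius's theorem no others up to isomorphism.
\<close>

end

(*
Call r admissible for f if Phi(t) mu(|f| > r t) <= 1 for all t > 0; the quasi-norm is the infimum
of the admissible r. If u < Phi2(t), then t >= Phi2^-1(u), so C2 t >= Phi1^-1(u) Phi3^-1(u), and
|fg| > 4 C2 r s t forces |f| > 2 r Phi1^-1(u) or |g| > 2 s Phi3^-1(u); by convexity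
Phi(2 Phi^-1(u)) >= 2u, so each of these two sets has measure at most 1/(2u).

Conversely, if l is not admissible for g, sigma-finiteness gives a set E of finite measure on which
|g| > l t with t >= Phi3^-1(1/mu E). Testing the multiplier on the indicator function of E yields the
lower norm bound. Boundedness of the multiplier is not needed in advance: if no l is admissible for g,
then weighted indicator functions of such sets for l = C1 4^(n+1) combine to a single f in wL^Phi1 with fg
outside wL^Phi2.
*)

theory Submission
  imports Defs
begin

text \<open>Every \<open>a > 0\<close> is the supremum of the values below it, and multiplication
  commutes with that supremum. The use: a factor \<open>\<Phi> t\<close>, possibly infinite, is
  replaced by real \<open>u > 0\<close> strictly below it, where the generalized inverses are
  positive reals.\<close>

lemma ennreal_mult_le_oneI:
  fixes a m :: ennreal
  assumes "\<And>u::real. 0 < u \<Longrightarrow> ennreal u < a \<Longrightarrow> ennreal u * m \<le> 1"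
  shows "a * m \<le> 1"
proof (cases "a = 0")
  case False
  have "v * m \<le> 1" if "v < a" for v
  proof (cases v)
    case (real u)
    then show ?thesis
      using assms[of u] that by (cases "u = 0") auto
  next
    case top
    then show ?thesis using that by simp
  qed
  then have "(SUP v\<in>{..<a}. v * m) \<le> 1"
    by (auto intro: SUP_least)
  moreover have "a = Sup {..<a}"
    by (simp add: False Sup_lessThan)
  then have "a * m = (SUP v\<in>{..<a}. v * m)"
    by (subst SUP_mult_right_ennreal[symmetric]) (use False in \<open>auto simp: bot_ennreal\<close>)
  ultimately show ?thesis by simp
qed simp

section \<open>Young functions\<close>

lemma young_function_mono: "young_function \<Phi> \<Longrightarrow> x \<le> y \<Longrightarrow> \<Phi> x \<le> \<Phi> y"
  by (auto simp: young_function_def mono_def)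

text \<open>\<open>x\<close> is the convex combination of \<open>0\<close> and \<open>d * x\<close>
  with weight \<open>1/d\<close> on the latter, and \<open>\<Phi> 0 = 0\<close>. Convexity is
  available only below \<open>young_b \<Phi>\<close>, hence the three cases: past that point the
  right side is infinite, and at it the bound follows from smaller \<open>d\<close> by monotonicity
  and \<open>d \<longlongrightarrow> c\<close>.\<close>

lemma young_function_superhomogeneous:
  fixes x c :: real
  assumes \<Phi>: "young_function \<Phi>" and c: "1 \<le> c" and x: "0 \<le> x"
  shows "ennreal c * \<Phi> (ennreal x) \<le> \<Phi> (ennreal (c * x))"
proof -
  have below: "ennreal d * \<Phi> (ennreal x) \<le> \<Phi> (ennreal (d * x))"
    if d: "1 \<le> d" and lt: "ennreal (d * x) < young_b \<Phi>" for d
  proof -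
    have eq: "ennreal (1 - 1/d) * 0 + ennreal (1/d) * ennreal (d * x) = ennreal x"
      using d x by (simp add: ennreal_mult[symmetric])
    have "\<Phi> (ennreal (1 - 1/d) * 0 + ennreal (1/d) * ennreal (d * x))
        \<le> ennreal (1 - 1/d) * \<Phi> 0 + ennreal (1/d) * \<Phi> (ennreal (d * x))"
    proof -
      have "0 < young_b \<Phi>" "0 \<le> 1/d" "1/d \<le> 1"
        using \<Phi> d by (auto simp: young_function_def)
      with \<Phi> lt show ?thesis unfolding young_function_def by blast
    qed
    moreover have "\<Phi> 0 = 0" using \<Phi> by (simp add: young_function_def)
    ultimately have "\<Phi> (ennreal x) \<le> ennreal (1/d) * \<Phi> (ennreal (d * x))"
      unfolding eq by simp
    then have "ennreal d * \<Phi> (ennreal x) \<le> ennreal d * (ennreal (1/d) * \<Phi> (ennreal (d * x)))"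
      by (rule mult_left_mono) simp
    also have "\<dots> = \<Phi> (ennreal (d * x))"
      using d by (simp add: mult.assoc[symmetric] ennreal_mult[symmetric])
    finally show ?thesis .
  qed
  consider "ennreal (c * x) < young_b \<Phi>" | "ennreal (c * x) > young_b \<Phi>"
    | "ennreal (c * x) = young_b \<Phi>" by (meson linorder_less_linear)
  then show ?thesis
  proof cases
    case 1
    then show ?thesis using below c by blast
  next
    case 2
    then obtain s where "\<Phi> s = \<infinity>" "s < ennreal (c * x)"
      unfolding young_b_def Inf_less_iff by auto
    then have "\<Phi> (ennreal (c * x)) = \<infinity>"
      using young_function_mono[OF \<Phi>, of s "ennreal (c * x)"] by (simp add: top_unique)
    then show ?thesis by simp
  next
    case 3
    have pos: "0 < c * x"
      using 3 \<Phi> by (metis ennreal_0 ennreal_neg less_irrefl linorder_not_le young_function_def)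
    show ?thesis
    proof (cases "c = 1")
      case False
      have "((\<lambda>d. ennreal d * \<Phi> (ennreal x)) \<longlongrightarrow> ennreal c * \<Phi> (ennreal x)) (at_left c)"
        if "\<Phi> (ennreal x) \<noteq> \<infinity>"
        using that by (intro tendsto_mult_ennreal tendsto_ennrealI tendsto_ident_at tendsto_const) (use pos c in auto)
      moreover have "eventually (\<lambda>d. ennreal d * \<Phi> (ennreal x) \<le> \<Phi> (ennreal (c * x))) (at_left c)"
      proof -
        have "eventually (\<lambda>d. d \<in> {1<..<c}) (at_left c)"
          using False c by (intro eventually_at_leftI[of 1]) auto
        then show ?thesis
        proof eventually_elim
          case (elim d)
          have "d * x < c * x" using elim pos x by (simp add: zero_less_mult_iff)
          then have "ennreal (d * x) < young_b \<Phi>"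
            unfolding 3[symmetric] using pos by (simp add: ennreal_less_iff elim x ennreal_lessI)
          then have "ennreal d * \<Phi> (ennreal x) \<le> \<Phi> (ennreal (d * x))"
            using below elim by auto
          also have "\<dots> \<le> \<Phi> (ennreal (c * x))"
            using \<open>d * x < c * x\<close> by (intro young_function_mono[OF \<Phi>] ennreal_leI) simp
          finally show ?case .
        qed
      qed
      moreover have "\<Phi> (ennreal x) \<noteq> \<infinity>"
      proof
        assume "\<Phi> (ennreal x) = \<infinity>"
        then have "young_b \<Phi> \<le> ennreal x" unfolding young_b_def by (auto intro: Inf_lower)
        then have "c * x \<le> x" unfolding 3[symmetric] using x by simp
        moreover have "0 < x" using pos x by (cases "x = 0") auto
        ultimately show False using False c by simp
      qed
      ultimately show ?thesis
        by (intro tendsto_upperbound[of _ _ "at_left c"]) auto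
    qed simp
  qed
qed

text \<open>Positivity comes from \<open>\<Phi>\<close> tending to \<open>0\<close> at
  \<open>0\<close>. Finiteness needs a finite point where \<open>\<Phi>\<close> exceeds
  \<open>u\<close>: the limit at infinity supplies it if
  \<open>young_b \<Phi> = \<infinity>\<close>, and otherwise \<open>\<Phi>\<close> already takes the
  value \<open>\<infinity>\<close> at a finite point.\<close>

lemma young_inverse_real:
  fixes u :: real
  assumes \<Phi>: "young_function \<Phi>" and u: "0 < u"
  obtains y :: real where "0 < y" and "young_inverse \<Phi> (ennreal u) = ennreal y"
proof -
  have *: "young_inverse \<Phi> (ennreal u) = Inf {t. \<Phi> t > ennreal u}"
    by (simp add: young_inverse_def)
  have "\<exists>t<\<infinity>. \<Phi> t > ennreal u"
  proof (cases "young_b \<Phi> = \<infinity>")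
    case True
    then have "(\<Phi> \<longlongrightarrow> \<infinity>) (at_left \<infinity>)" using \<Phi> by (simp add: young_function_def)
    then have "eventually (\<lambda>t. ennreal u < \<Phi> t) (at_left \<infinity>)"
      by (rule order_tendstoD) simp
    then obtain b where "b < \<infinity>" "\<And>t. b < t \<Longrightarrow> t < \<infinity> \<Longrightarrow> ennreal u < \<Phi> t"
      unfolding infinity_ennreal_def eventually_at_left[OF ennreal_zero_less_top] by auto
    then show ?thesis using dense by blast
  next
    case False
    then have "young_b \<Phi> < \<infinity>" by (simp add: less_top)
    then obtain t where "\<Phi> t = \<infinity>" "t < \<infinity>"
      unfolding young_b_def Inf_less_iff by auto
    then show ?thesis by (intro exI[of _ t]) simp
  qed
  then have fin: "young_inverse \<Phi> (ennreal u) < \<infinity>"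
    unfolding * Inf_less_iff by auto
  have "eventually (\<lambda>t. \<Phi> t < ennreal u) (at_right 0)"
    using \<Phi> u by (intro order_tendstoD(2)[of _ 0]) (auto simp: young_function_def)
  then obtain b where b: "0 < b" "\<And>t. 0 < t \<Longrightarrow> t < b \<Longrightarrow> \<Phi> t < ennreal u"
    unfolding eventually_at_right[OF zero_less_one] by auto
  then obtain t where t: "0 < t" "t < b" using dense by blast
  have "t \<le> young_inverse \<Phi> (ennreal u)"
    unfolding *
  proof (rule Inf_greatest)
    fix s assume "s \<in> {t. ennreal u < \<Phi> t}"
    then show "t \<le> s"
      using b(2)[OF t] young_function_mono[OF \<Phi>, of s t] by (metis leD linear mem_Collect_eq order.strict_trans2 order_less_imp_le)
  qed
  then have "0 < young_inverse \<Phi> (ennreal u)" using t by simp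
  with fin that show ?thesis
    by (cases "young_inverse \<Phi> (ennreal u)") auto
qed

lemma young_inverse_le:
  "ennreal u < \<Phi> t \<Longrightarrow> young_inverse \<Phi> (ennreal u) \<le> t"
  by (auto simp: young_inverse_def intro: Inf_lower)

lemma young_le_of_less_inverse:
  "t < young_inverse \<Phi> (ennreal u) \<Longrightarrow> \<Phi> t \<le> ennreal u"
  using young_inverse_le[of u \<Phi> t] by (meson leD not_le)

lemma young_inverse_less:
  assumes "young_function \<Phi>" and "young_inverse \<Phi> (ennreal u) < t"
  shows "ennreal u < \<Phi> t"
  using assms(2) young_function_mono[OF assms(1)]
  by (auto simp: young_inverse_def Inf_less_iff intro: less_le_trans)

text \<open>At \<open>y\<close> itself \<open>\<Phi>\<close> may be below \<open>u\<close>, namely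
  when it jumps to infinity just after \<open>y\<close>. So the argument starts at
  \<open>d * y\<close> with \<open>d > 1\<close>, where \<open>\<Phi>\<close> exceeds
  \<open>u\<close>, stretches by \<open>2 / d\<close> using superhomogeneity, and lets
  \<open>d\<close> tend to \<open>1\<close>.\<close>

lemma young_twice_inverse_ge:
  assumes \<Phi>: "young_function \<Phi>" and y: "young_inverse \<Phi> (ennreal u) = ennreal y" "0 < y"
    and u: "0 < u"
  shows "ennreal (2 * u) \<le> \<Phi> (ennreal (2 * y))"
proof (rule tendsto_upperbound)
  show "((\<lambda>d. ennreal (2 / d * u)) \<longlongrightarrow> ennreal (2 * u)) (at_right 1)"
    by (rule tendsto_eq_intros refl | simp)+
  have "eventually (\<lambda>d. d \<in> {1<..<2}) (at_right (1::real))"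
    by (intro eventually_at_rightI[of _ 2]) auto
  then show "eventually (\<lambda>d. ennreal (2 / d * u) \<le> \<Phi> (ennreal (2 * y))) (at_right 1)"
  proof eventually_elim
    case (elim d)
    have "ennreal u < \<Phi> (ennreal (d * y))"
      using elim y by (intro young_inverse_less[OF \<Phi>]) (auto intro: ennreal_lessI)
    then have "ennreal (2 / d) * ennreal u \<le> ennreal (2 / d) * \<Phi> (ennreal (d * y))"
      by (intro mult_left_mono) auto
    also have "\<dots> \<le> \<Phi> (ennreal (2 / d * (d * y)))"
      using elim y by (intro young_function_superhomogeneous[OF \<Phi>]) auto
    also have "2 / d * (d * y) = 2 * y" using elim by simp
    finally show ?case
      using elim u by (simp add: ennreal_mult[symmetric] del: times_divide_eq_left)
  qed
qed simp

section \<open>Admissible constants\<close>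

text \<open>The condition under the infimum of the quasi-norm, with the supremum unfolded,
  \<open>t\<close> made real and the division by \<open>r\<close> moved into the level.\<close>

definition weak_orlicz_admissible ::
    "'x measure \<Rightarrow> (ennreal \<Rightarrow> ennreal) \<Rightarrow> ('x \<Rightarrow> 'a::real_normed_field) \<Rightarrow> real \<Rightarrow> bool" where
  "weak_orlicz_admissible M \<Phi> f r \<longleftrightarrow> 0 < r \<and>
     (\<forall>t>0. \<Phi> (ennreal t) * emeasure M {x \<in> space M. r * t < norm (f x)} \<le> 1)"

lemma SUP_distr_fun_eq:
  fixes f :: "'x \<Rightarrow> 'a::real_normed_field"
  assumes "0 < r"
  shows "(SUP t\<in>{0<..<\<infinity>}. \<Phi> t * distr_fun M (\<lambda>x. f x / of_real r) t)
    = (SUP t\<in>{0<..}. \<Phi> (ennreal t) * emeasure M {x \<in> space M. r * t < norm (f x)})"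
proof -
  have *: "{0<..<\<infinity>} = ennreal ` {0<..}"
  proof (intro equalityI subsetI)
    fix t :: ennreal assume "t \<in> {0<..<\<infinity>}"
    then show "t \<in> ennreal ` {0<..}" by (cases t) auto
  qed auto
  have "{x \<in> space M. ennreal t < ennreal (norm (f x / of_real r))}
      = {x \<in> space M. r * t < norm (f x)}" if "0 < t" for t
    using assms that by (auto simp: norm_divide ennreal_less_iff field_simps)
  then show ?thesis
    unfolding * image_image distr_fun_def by (intro SUP_cong refl) simp
qed

lemma weak_orlicz_norm_eq:
  "weak_orlicz_norm M \<Phi> f = (INF r\<in>{r. weak_orlicz_admissible M \<Phi> f r}. ennreal r)"
proof -
  have "(0 < r \<and> (SUP t\<in>{0<..<\<infinity>}. \<Phi> t * distr_fun M (\<lambda>x. f x / of_real r) t) \<le> 1)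
      \<longleftrightarrow> weak_orlicz_admissible M \<Phi> f r" for r
  proof (cases "0 < r")
    case True
    then show ?thesis
      unfolding SUP_distr_fun_eq[OF True] by (auto simp: weak_orlicz_admissible_def SUP_le_iff)
  qed (simp add: weak_orlicz_admissible_def)
  then show ?thesis unfolding weak_orlicz_norm_def by simp
qed

lemma weak_orlicz_norm_le:
  "weak_orlicz_admissible M \<Phi> f r \<Longrightarrow> weak_orlicz_norm M \<Phi> f \<le> ennreal r"
  unfolding weak_orlicz_norm_eq by (auto intro: INF_lower)

lemma weak_orlicz_admissible_mono:
  fixes f :: "'x \<Rightarrow> 'a::real_normed_field"
  assumes f: "f \<in> borel_measurable M" and r: "weak_orlicz_admissible M \<Phi> f r" and s: "r \<le> s"
  shows "weak_orlicz_admissible M \<Phi> f s"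
  unfolding weak_orlicz_admissible_def
proof (intro conjI allI impI)
  show "0 < s" using r s by (simp add: weak_orlicz_admissible_def)
  fix t :: real assume t: "0 < t"
  have "{x \<in> space M. s * t < norm (f x)} \<subseteq> {x \<in> space M. r * t < norm (f x)}"
    using s t by (auto intro: le_less_trans[OF mult_right_mono])
  then have "\<Phi> (ennreal t) * emeasure M {x \<in> space M. s * t < norm (f x)}
      \<le> \<Phi> (ennreal t) * emeasure M {x \<in> space M. r * t < norm (f x)}"
    using f by (intro mult_left_mono emeasure_mono) auto
  also have "\<dots> \<le> 1" using r t by (simp add: weak_orlicz_admissible_def)
  finally show "\<Phi> (ennreal t) * emeasure M {x \<in> space M. s * t < norm (f x)} \<le> 1" .
qed

lemma weak_orlicz_admissible_of_norm_less:
  assumes "f \<in> borel_measurable M" and "weak_orlicz_norm M \<Phi> f < ennreal r"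
  shows "weak_orlicz_admissible M \<Phi> f r"
  using assms(2) weak_orlicz_admissible_mono[OF assms(1)]
  unfolding weak_orlicz_norm_eq Inf_less_iff
  by (auto simp: weak_orlicz_admissible_def ennreal_less_iff)

text \<open>Membership asks only for a finite supremum, admissibility for the bound
  \<open>1\<close>. Superhomogeneity closes the gap: enlarging the constant by a factor
  \<open>c \<ge> 1\<close> divides the supremum by at least \<open>c\<close>.\<close>

lemma weak_orlicz_iff:
  fixes f :: "'x \<Rightarrow> 'a::real_normed_field"
  assumes \<Phi>: "young_function \<Phi>"
  shows "f \<in> weak_orlicz M \<Phi> \<longleftrightarrow>
    f \<in> borel_measurable M \<and> (\<exists>r. weak_orlicz_admissible M \<Phi> f r)"
proof (intro iffI conjI)
  assume f: "f \<in> weak_orlicz M \<Phi>"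
  then show "f \<in> borel_measurable M" by (simp add: weak_orlicz_def)
  from f obtain \<epsilon> :: real where \<epsilon>: "0 < \<epsilon>"
      "(SUP t\<in>{0<..<\<infinity>}. \<Phi> t * distr_fun M (\<lambda>x. of_real \<epsilon> * f x) t) < \<infinity>"
    by (auto simp: weak_orlicz_def)
  define S where "S = (SUP t\<in>{0<..}. \<Phi> (ennreal t) * emeasure M {x \<in> space M. 1/\<epsilon> * t < norm (f x)})"
  have "(\<lambda>x. of_real \<epsilon> * f x) = (\<lambda>x. f x / of_real (1/\<epsilon>))"
    by (auto simp: field_simps)
  then have "S < \<infinity>"
    using \<epsilon> SUP_distr_fun_eq[of "1/\<epsilon>" \<Phi> M f] unfolding S_def by simp
  then obtain s where s: "0 \<le> s" "S = ennreal s" by (cases S) auto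
  \<comment> \<open>The maximum with \<open>1\<close> keeps \<open>c\<close> in the range of
    superhomogeneity even if the supremum \<open>s\<close> is small or zero.\<close>
  define c where "c = max 1 s"
  have c: "1 \<le> c" "s \<le> c" by (auto simp: c_def)
  have "weak_orlicz_admissible M \<Phi> f (c/\<epsilon>)"
    unfolding weak_orlicz_admissible_def
  proof (intro conjI allI impI)
    show "0 < c/\<epsilon>" using c \<epsilon> by simp
    fix t :: real assume t: "0 < t"
    let ?m = "emeasure M {x \<in> space M. c / \<epsilon> * t < norm (f x)}"
    have "ennreal c * \<Phi> (ennreal t) * ?m \<le> \<Phi> (ennreal (c * t)) * ?m"
      using c t by (intro mult_right_mono young_function_superhomogeneous[OF \<Phi>]) auto
    also have "\<dots> = \<Phi> (ennreal (c * t)) * emeasure M {x \<in> space M. 1/\<epsilon> * (c * t) < norm (f x)}"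
      by simp
    also have "\<dots> \<le> S"
      unfolding S_def using c t by (intro SUP_upper2[of "c * t"]) auto
    also have "\<dots> \<le> ennreal c" using s c by (simp add: ennreal_leI)
    finally have "ennreal (1/c) * (ennreal c * \<Phi> (ennreal t) * ?m) \<le> ennreal (1/c) * ennreal c"
      by (intro mult_left_mono) auto
    then show "\<Phi> (ennreal t) * ?m \<le> 1"
      using c by (simp add: mult.assoc[symmetric] ennreal_mult[symmetric])
  qed
  then show "\<exists>r. weak_orlicz_admissible M \<Phi> f r" ..
next
  assume "f \<in> borel_measurable M \<and> (\<exists>r. weak_orlicz_admissible M \<Phi> f r)"
  then obtain r where f: "f \<in> borel_measurable M" and r: "weak_orlicz_admissible M \<Phi> f r" by blast
  have "(SUP t\<in>{0<..<\<infinity>}. \<Phi> t * distr_fun M (\<lambda>x. f x / of_real r) t) \<le> 1"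
    using r by (subst SUP_distr_fun_eq) (auto simp: weak_orlicz_admissible_def SUP_le_iff)
  then have "(SUP t\<in>{0<..<\<infinity>}. \<Phi> t * distr_fun M (\<lambda>x. of_real (1/r) * f x) t) < \<infinity>"
    by (simp add: field_simps le_less_trans[OF _ ennreal_one_less_top])
  moreover have "0 < 1/r" using r by (simp add: weak_orlicz_admissible_def)
  ultimately show "f \<in> weak_orlicz M \<Phi>"
    using f unfolding weak_orlicz_def by blast
qed

lemma weak_orlicz_norm_finite:
  assumes "young_function \<Phi>" and "f \<in> weak_orlicz M \<Phi>"
  shows "weak_orlicz_norm M \<Phi> f < \<infinity>"
  using assms weak_orlicz_norm_le by (metis weak_orlicz_iff ennreal_less_top infinity_ennreal_def le_less_trans)

section \<open>Pointwise multipliers\<close>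

text \<open>Doubling the level at least doubles the lower bound \<open>u\<close> for
  \<open>\<Phi>\<close>. The resulting \<open>1/2\<close> is what allows two such sets, one for each
  factor of a product, to be added.\<close>

lemma emeasure_above_twice_inverse_le:
  fixes f :: "'x \<Rightarrow> 'a::real_normed_field"
  assumes \<Phi>: "young_function \<Phi>" and r: "weak_orlicz_admissible M \<Phi> f r"
    and u: "0 < u" and y: "young_inverse \<Phi> (ennreal u) = ennreal y" "0 < y"
  shows "ennreal u * emeasure M {x \<in> space M. r * (2 * y) < norm (f x)} \<le> ennreal (1/2)"
proof -
  let ?m = "emeasure M {x \<in> space M. r * (2 * y) < norm (f x)}"
  have "ennreal (2 * u) * ?m \<le> \<Phi> (ennreal (2 * y)) * ?m"
    by (intro mult_right_mono young_twice_inverse_ge[OF \<Phi> y u]) simp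
  also have "\<dots> \<le> 1" using r y by (simp add: weak_orlicz_admissible_def)
  finally have "ennreal (1/2) * (ennreal (2 * u) * ?m) \<le> ennreal (1/2) * 1"
    by (rule mult_left_mono) simp
  moreover have "ennreal (1/2) * ennreal (2 * u) = ennreal u"
    by (subst ennreal_mult[symmetric]) (use u in auto)
  ultimately show ?thesis by (simp only: mult.assoc[symmetric] mult_1_right)
qed

text \<open>The \<open>4\<close> is the product of the two factors \<open>2\<close> in the levels
  for \<open>f\<close> and \<open>g\<close>. Both levels are governed by one common \<open>u\<close>
  below \<open>\<Phi>2 (ennreal t)\<close>.\<close>

lemma weak_orlicz_admissible_mult:
  fixes f g :: "'x \<Rightarrow> 'a::{real_normed_field, euclidean_space}"
  assumes \<Phi>: "young_function \<Phi>1" "young_function \<Phi>2" "young_function \<Phi>3"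
    and C: "0 < C" "\<And>u. 0 < u \<Longrightarrow> u < \<infinity> \<Longrightarrow>
      young_inverse \<Phi>1 u * young_inverse \<Phi>3 u \<le> ennreal C * young_inverse \<Phi>2 u"
    and meas: "f \<in> borel_measurable M" "g \<in> borel_measurable M"
    and f: "weak_orlicz_admissible M \<Phi>1 f r" and g: "weak_orlicz_admissible M \<Phi>3 g s"
  shows "weak_orlicz_admissible M \<Phi>2 (\<lambda>x. f x * g x) (4 * C * r * s)"
  unfolding weak_orlicz_admissible_def
proof (intro conjI allI impI)
  have r: "0 < r" and s: "0 < s" using f g by (auto simp: weak_orlicz_admissible_def)
  with C show "0 < 4 * C * r * s" by simp
  fix t :: real assume t: "0 < t"
  show "\<Phi>2 (ennreal t) * emeasure M {x \<in> space M. 4 * C * r * s * t < norm (f x * g x)} \<le> 1"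
  proof (rule ennreal_mult_le_oneI)
    fix u :: real assume u: "0 < u" "ennreal u < \<Phi>2 (ennreal t)"
    obtain a where a: "0 < a" "young_inverse \<Phi>1 (ennreal u) = ennreal a"
      using young_inverse_real[OF \<Phi>(1) u(1)] .
    obtain c where c: "0 < c" "young_inverse \<Phi>3 (ennreal u) = ennreal c"
      using young_inverse_real[OF \<Phi>(3) u(1)] .
    have "ennreal (a * c) \<le> ennreal C * young_inverse \<Phi>2 (ennreal u)"
      using C(2)[of "ennreal u"] u a c by (simp add: ennreal_mult)
    also have "\<dots> \<le> ennreal C * ennreal t"
      using young_inverse_le[of u \<Phi>2 "ennreal t"] u(2) by (intro mult_left_mono) auto
    finally have ac: "a * c \<le> C * t"
      using C t by (simp add: ennreal_mult[symmetric])
    let ?A = "{x \<in> space M. r * (2 * a) < norm (f x)}"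
    let ?B = "{x \<in> space M. s * (2 * c) < norm (g x)}"
    let ?D = "{x \<in> space M. 4 * C * r * s * t < norm (f x * g x)}"
    \<comment> \<open>Outside both sets the product is at most \<open>4 * r * s * (a * c)\<close>,
      and \<open>a * c \<le> C * t\<close>.\<close>
    have "?D \<subseteq> ?A \<union> ?B"
    proof (rule ccontr)
      assume "\<not> ?D \<subseteq> ?A \<union> ?B"
      then obtain x where x: "4 * C * r * s * t < norm (f x) * norm (g x)"
          "norm (f x) \<le> r * (2 * a)" "norm (g x) \<le> s * (2 * c)"
        by (force simp: norm_mult)
      have "norm (f x) * norm (g x) \<le> (r * (2 * a)) * (s * (2 * c))"
        using x a r by (intro mult_mono) auto
      also have "\<dots> = 4 * r * s * (a * c)" by simp
      also have "\<dots> \<le> 4 * r * s * (C * t)"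
        using ac r s by (intro mult_left_mono) auto
      finally show False using x(1) by (simp add: mult_ac)
    qed
    then have "ennreal u * emeasure M ?D \<le> ennreal u * (emeasure M ?A + emeasure M ?B)"
      using meas by (intro mult_left_mono order_trans[OF emeasure_mono emeasure_subadditive]) auto
    also have "\<dots> \<le> ennreal (1/2) + ennreal (1/2)"
      unfolding distrib_left using u a c
      by (intro add_mono emeasure_above_twice_inverse_le[OF \<Phi>(1) f]
          emeasure_above_twice_inverse_le[OF \<Phi>(3) g]) auto
    also have "\<dots> = 1" by (subst ennreal_plus[symmetric]) simp_all
    finally show "ennreal u * emeasure M ?D \<le> 1" .
  qed
qed

section \<open>Lower norm bound by testing on indicators\<close>

text \<open>The level set violating the bound may have infinite measure. Intersecting it with an
  exhaustion by sets of finite measure, continuity from below keeps the product above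
  \<open>1\<close> at some stage. Then \<open>1/m\<close> is a positive real at which the inverses
  can be evaluated.\<close>

lemma not_admissible_finite_witness:
  fixes g :: "'x \<Rightarrow> 'a::{real_normed_field, euclidean_space}"
  assumes "sigma_finite_measure M" and g: "g \<in> borel_measurable M"
    and l: "0 < l" "\<not> weak_orlicz_admissible M \<Phi> g l"
  obtains E m t where "E \<in> sets M" "0 < m" "emeasure M E = ennreal m" "0 < t"
    "ennreal (1/m) < \<Phi> (ennreal t)" "\<forall>x\<in>E. l * t < norm (g x)"
proof -
  interpret sigma_finite_measure M by fact
  obtain t where t: "0 < t" and
    gt: "1 < \<Phi> (ennreal t) * emeasure M {x \<in> space M. l * t < norm (g x)}"
    using l by (auto simp: weak_orlicz_admissible_def not_le)
  let ?G = "{x \<in> space M. l * t < norm (g x)}"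
  have G: "?G \<in> sets M" using g by measurable
  obtain A :: "nat \<Rightarrow> 'x set" where A: "range A \<subseteq> sets M" "(\<Union>i. A i) = space M"
      "\<And>i. emeasure M (A i) \<noteq> \<infinity>" "incseq A"
    using sigma_finite_incseq by blast
  have "incseq (\<lambda>i. ?G \<inter> A i)"
    using A(4) unfolding incseq_def by blast
  then have "(SUP i. emeasure M (?G \<inter> A i)) = emeasure M (\<Union>i. ?G \<inter> A i)"
    using A(1) G by (intro SUP_emeasure_incseq) auto
  also have "(\<Union>i. ?G \<inter> A i) = ?G" using A(2) by blast
  finally have SUP_eq: "(SUP i. emeasure M (?G \<inter> A i)) = emeasure M ?G" .
  have "\<Phi> (ennreal t) * emeasure M ?G = (SUP i. \<Phi> (ennreal t) * emeasure M (?G \<inter> A i))"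
    unfolding SUP_eq[symmetric] by (rule SUP_mult_left_ennreal)
  with gt obtain i where i: "1 < \<Phi> (ennreal t) * emeasure M (?G \<inter> A i)"
    by (auto simp: less_SUP_iff)
  have "emeasure M (?G \<inter> A i) \<le> emeasure M (A i)"
    using A(1) by (intro emeasure_mono) auto
  then have "emeasure M (?G \<inter> A i) < \<infinity>"
    using A(3)[of i] by (simp add: less_top le_less_trans)
  then obtain m where m: "0 \<le> m" "emeasure M (?G \<inter> A i) = ennreal m"
    by (cases "emeasure M (?G \<inter> A i)") auto
  have "0 < m" using i m by (cases "m = 0") auto
  have "ennreal (1/m) < \<Phi> (ennreal t)"
  proof (rule ccontr)
    assume "\<not> ?thesis"
    then have "\<Phi> (ennreal t) * ennreal m \<le> ennreal (1/m) * ennreal m"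
      by (intro mult_right_mono) auto
    also have "\<dots> = 1" using \<open>0 < m\<close> by (simp add: ennreal_mult[symmetric])
    finally show False using i m by simp
  qed
  moreover have "?G \<inter> A i \<in> sets M" using G A(1) by auto
  ultimately show thesis
    using that[of "?G \<inter> A i" m t] \<open>0 < m\<close> m(2) t by blast
qed

text \<open>The relevant level set is inside \<open>E\<close> for \<open>t < y\<close> and empty for
  \<open>t \<ge> y\<close>. For \<open>t < y\<close> the definition of the inverse gives
  \<open>\<Phi> t \<le> 1/m\<close>; since the level sets are strict, the endpoint
  \<open>t = y\<close> falls into the empty case.\<close>

lemma indicator_admissible:
  assumes \<Phi>: "young_function \<Phi>" and E: "E \<in> sets M" "emeasure M E = ennreal m" "0 < m"
    and y: "young_inverse \<Phi> (ennreal (1/m)) = ennreal y" "0 < y"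
  shows "weak_orlicz_admissible M \<Phi> (indicator E :: 'x \<Rightarrow> 'a::real_normed_field) (1/y)"
  unfolding weak_orlicz_admissible_def
proof (intro conjI allI impI)
  show "0 < 1/y" using y by simp
  fix t :: real assume t: "0 < t"
  let ?D = "{x \<in> space M. 1/y * t < norm (indicator E x :: 'a)}"
  have D: "?D \<subseteq> (if t < y then E else {})"
    using y t by (auto simp: indicator_def field_simps split: if_splits)
  show "\<Phi> (ennreal t) * emeasure M ?D \<le> 1"
  proof (cases "t < y")
    case True
    have "\<Phi> (ennreal t) * emeasure M ?D \<le> ennreal (1/m) * ennreal m"
    proof (rule mult_mono)
      show "\<Phi> (ennreal t) \<le> ennreal (1/m)"
        using True y t by (intro young_le_of_less_inverse) (simp add: ennreal_less_iff)
      show "emeasure M ?D \<le> ennreal m"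
        using True D E emeasure_mono[of ?D E M] by simp
    qed auto
    also have "\<dots> = 1" using E by (simp add: ennreal_mult[symmetric])
    finally show ?thesis .
  next
    case False
    with D have "?D = {}" by simp
    then show ?thesis by (simp only: emeasure_empty mult_zero_right zero_le_one)
  qed
qed

text \<open>If some \<open>l > C * K\<close> were not admissible for \<open>g\<close>, the witness
  set \<open>E\<close> would give a contradiction: the indicator has norm at most
  \<open>1/a\<close>, so its product with \<open>g\<close> has norm at most \<open>K/a\<close>,
  whereas \<open>g\<close> is too large on \<open>E\<close> for this.\<close>

lemma weak_orlicz_norm_le_of_multiplier_bound:
  fixes g :: "'x \<Rightarrow> 'a::{real_normed_field, euclidean_space}"
  assumes \<sigma>: "sigma_finite_measure M"
    and \<Phi>: "young_function \<Phi>1" "young_function \<Phi>2" "young_function \<Phi>3"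
    and C: "0 < C" "\<And>u. 0 < u \<Longrightarrow> u < \<infinity> \<Longrightarrow>
      ennreal (1 / C) * young_inverse \<Phi>2 u \<le> young_inverse \<Phi>1 u * young_inverse \<Phi>3 u"
    and g: "g \<in> borel_measurable M"
    and K: "0 \<le> K" "\<And>f. f \<in> weak_orlicz M \<Phi>1 \<Longrightarrow>
      weak_orlicz_norm M \<Phi>2 (\<lambda>x. f x * g x) \<le> ennreal K * weak_orlicz_norm M \<Phi>1 f"
  shows "weak_orlicz_norm M \<Phi>3 g \<le> ennreal (C * K)"
proof (rule ennreal_le_epsilon)
  fix e :: real assume e: "0 < e"
  define l where "l = C * K + e"
  have l: "0 < l" "C * K < l" using e C K by (auto simp: l_def add_nonneg_pos)
  have "weak_orlicz_admissible M \<Phi>3 g l"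
  proof (rule ccontr)
    assume "\<not> ?thesis"
    from not_admissible_finite_witness[OF \<sigma> g l(1) this]
    obtain E m t where E: "E \<in> sets M" "0 < m" "emeasure M E = ennreal m" and t: "0 < t"
      "ennreal (1/m) < \<Phi>3 (ennreal t)" "\<forall>x\<in>E. l * t < norm (g x)" .
    have m: "0 < 1/m" using E by simp
    obtain a where a: "0 < a" "young_inverse \<Phi>1 (ennreal (1/m)) = ennreal a"
      using young_inverse_real[OF \<Phi>(1) m] .
    obtain b where b: "0 < b" "young_inverse \<Phi>2 (ennreal (1/m)) = ennreal b"
      using young_inverse_real[OF \<Phi>(2) m] .
    \<comment> \<open>The third inverse at \<open>1/m\<close> is at most \<open>t\<close>, because
      \<open>\<Phi>3\<close> already exceeds \<open>1/m\<close> there; this eliminates it from the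
      hypothesis.\<close>
    have "ennreal (1/C * b) \<le> ennreal a * young_inverse \<Phi>3 (ennreal (1/m))"
      using C(2)[of "ennreal (1/m)"] m a b C(1) by (subst ennreal_mult) auto
    also have "\<dots> \<le> ennreal (a * t)"
      using young_inverse_le[of "1/m" \<Phi>3 "ennreal t"] t a
      by (subst ennreal_mult) (auto intro: mult_left_mono)
    finally have bt: "b \<le> C * (a * t)"
      using a t C by (simp add: field_simps)
    let ?\<chi> = "indicator E :: 'x \<Rightarrow> 'a"
    have \<chi>: "weak_orlicz_admissible M \<Phi>1 ?\<chi> (1/a)"
      using indicator_admissible[OF \<Phi>(1) E(1,3,2) a(2,1)] .
    have "?\<chi> \<in> weak_orlicz M \<Phi>1"
      unfolding weak_orlicz_iff[OF \<Phi>(1)] using \<chi> E by auto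
    then have "weak_orlicz_norm M \<Phi>2 (\<lambda>x. ?\<chi> x * g x) \<le> ennreal K * weak_orlicz_norm M \<Phi>1 ?\<chi>"
      by (rule K)
    also have "\<dots> \<le> ennreal K * ennreal (1/a)"
      using weak_orlicz_norm_le[OF \<chi>] by (rule mult_left_mono) simp
    also have "\<dots> = ennreal (K/a)" using K a by (simp add: ennreal_mult[symmetric])
    finally have le: "weak_orlicz_norm M \<Phi>2 (\<lambda>x. ?\<chi> x * g x) \<le> ennreal (K/a)" .
    \<comment> \<open>A constant strictly between the bound \<open>K/a\<close> and the value \<open>l/(C a)\<close> forced by \<open>g\<close> on \<open>E\<close>.\<close>
    obtain k where k: "K < k" "k < l/C"
      using dense[of K "l/C"] l C by (auto simp: field_simps)
    have "ennreal (K/a) < ennreal (k/a)"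
      using k a K by (intro ennreal_lessI divide_strict_right_mono) auto
    with le have adm: "weak_orlicz_admissible M \<Phi>2 (\<lambda>x. ?\<chi> x * g x) (k/a)"
      using E g by (intro weak_orlicz_admissible_of_norm_less) (auto intro: le_less_trans)
    \<comment> \<open>Chosen so that \<open>k/a * s = l * t\<close>, the level that \<open>g\<close>
      exceeds on \<open>E\<close>. The inequality \<open>k < l/C\<close> puts \<open>s\<close>
      strictly beyond \<open>b\<close>, hence \<open>\<Phi>2\<close> above
      \<open>1/m\<close>.\<close>
    define s where "s = l * t / (k/a)"
    have kpos: "0 < k" using k K by simp
    have "b < s"
    proof -
      have "b * k \<le> C * (a * t) * k" using bt kpos by simp
      also have "\<dots> < C * (a * t) * (l/C)" using k C a t by (intro mult_strict_left_mono) auto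
      also have "\<dots> = l * t * a" using C by simp
      finally show ?thesis unfolding s_def using kpos a by (simp add: field_simps)
    qed
    then have s: "ennreal (1/m) < \<Phi>2 (ennreal s)"
      using b by (intro young_inverse_less[OF \<Phi>(2)]) (auto intro: ennreal_lessI)
    have "E \<subseteq> {x \<in> space M. k/a * s < norm (?\<chi> x * g x)}"
      using sets.sets_into_space[OF E(1)] t(3) kpos a by (auto simp: s_def)
    then have "emeasure M E \<le> emeasure M {x \<in> space M. k/a * s < norm (?\<chi> x * g x)}"
      using E g by (intro emeasure_mono) auto
    then have "\<Phi>2 (ennreal s) * ennreal m \<le> 1"
      using adm \<open>b < s\<close> b E unfolding weak_orlicz_admissible_def
      by (metis (no_types, lifting) less_trans mult_left_mono order_trans zero_le)
    moreover have "ennreal (1/m) * ennreal m < \<Phi>2 (ennreal s) * ennreal m"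
      using s E by (intro ennreal_mult_strict_right_mono) auto
    moreover have "ennreal (1/m) * ennreal m = 1"
      using E by (simp add: ennreal_mult[symmetric])
    ultimately show False by simp
  qed
  then have "weak_orlicz_norm M \<Phi>3 g \<le> ennreal l" by (rule weak_orlicz_norm_le)
  also have "\<dots> = ennreal (C * K) + ennreal e"
    using C K e by (simp add: l_def ennreal_plus)
  finally show "weak_orlicz_norm M \<Phi>3 g \<le> ennreal (C * K) + ennreal e" .
qed

section \<open>Gliding hump: membership of multipliers\<close>

text \<open>Each indicator of \<open>E n\<close> scaled to height \<open>y n\<close> just meets the
  bound \<open>1\<close>. Lowering the heights by \<open>2 ^ Suc n\<close> reduces the contributions
  to a geometric series with sum \<open>1\<close>, so all of them fit into one function.\<close>

lemma weak_orlicz_gliding_hump: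
  fixes E :: "nat \<Rightarrow> 'x set" and m y :: "nat \<Rightarrow> real"
  assumes \<Phi>: "young_function \<Phi>"
    and E: "\<And>n. E n \<in> sets M" "\<And>n. emeasure M (E n) = ennreal (m n)" "\<And>n. 0 < m n"
    and y: "\<And>n. young_inverse \<Phi> (ennreal (1 / m n)) = ennreal (y n)" "\<And>n. 0 < y n"
  obtains f :: "'x \<Rightarrow> real" where "f \<in> borel_measurable M" "weak_orlicz_admissible M \<Phi> f 1"
    "\<forall>n. AE x in M. x \<in> E n \<longrightarrow> y n / 2 ^ Suc n \<le> f x"
proof -
  define z where "z n = y n / 2 ^ Suc n" for n
  have z: "0 < z n" for n using y by (simp add: z_def)
  \<comment> \<open>A supremum instead of a sum: its level set at \<open>t\<close> lies in the union
    of those \<open>E n\<close> with \<open>t < z n\<close>, so countable subadditivity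
    suffices.\<close>
  define h :: "'x \<Rightarrow> ennreal" where "h x = (SUP n. ennreal (z n) * indicator (E n) x)" for x
  have [measurable]: "E n \<in> sets M" for n by (rule E)
  have h[measurable]: "h \<in> borel_measurable M" unfolding h_def by measurable
  have bound: "\<Phi> (ennreal t) * emeasure M {x \<in> space M. ennreal t < h x} \<le> 1" if t: "0 < t" for t
  proof -
    define D where "D n = (if t < z n then E n else {})" for n
    have D: "D n \<in> sets M" for n by (simp add: D_def)
    have "{x \<in> space M. ennreal t < h x} \<subseteq> (\<Union>n. D n)"
      using t by (auto simp: h_def less_SUP_iff D_def indicator_def ennreal_less_iff split: if_splits)
    then have "emeasure M {x \<in> space M. ennreal t < h x} \<le> emeasure M (\<Union>n. D n)"
      using D by (intro emeasure_mono) auto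
    also have "\<dots> \<le> (\<Sum>n. emeasure M (D n))"
      using D by (intro emeasure_subadditive_countably) auto
    finally have "\<Phi> (ennreal t) * emeasure M {x \<in> space M. ennreal t < h x}
        \<le> \<Phi> (ennreal t) * (\<Sum>n. emeasure M (D n))"
      by (rule mult_left_mono) simp
    also have "\<dots> = (\<Sum>n. \<Phi> (ennreal t) * emeasure M (D n))" by simp
    also have "\<dots> \<le> (\<Sum>n. ennreal ((1/2) ^ Suc n))"
    proof (intro suminf_le summableI)
      fix n
      show "\<Phi> (ennreal t) * emeasure M (D n) \<le> ennreal ((1/2) ^ Suc n)"
      proof (cases "t < z n")
        case True
        \<comment> \<open>Since \<open>z n\<close> is \<open>y n\<close> divided by
          \<open>2 ^ Suc n\<close>, the stretched argument is still below the inverse;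
          superhomogeneity turns the stretch into the factor \<open>(1/2) ^ Suc n\<close>.\<close>
        have "ennreal (2 ^ Suc n * t) < young_inverse \<Phi> (ennreal (1 / m n))"
          unfolding y using True t by (intro ennreal_lessI y) (simp add: z_def field_simps)
        then have le: "\<Phi> (ennreal (2 ^ Suc n * t)) \<le> ennreal (1 / m n)"
          by (rule young_le_of_less_inverse)
        have "ennreal (2 ^ Suc n) * \<Phi> (ennreal t) \<le> \<Phi> (ennreal (2 ^ Suc n * t))"
          using t one_le_power[of "2::real" "Suc n"]
          by (intro young_function_superhomogeneous[OF \<Phi>]) auto
        with le have "ennreal (2 ^ Suc n) * \<Phi> (ennreal t) \<le> ennreal (1 / m n)" by simp
        then have "ennreal (m n * (1/2) ^ Suc n) * (ennreal (2 ^ Suc n) * \<Phi> (ennreal t))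
            \<le> ennreal (m n * (1/2) ^ Suc n) * ennreal (1 / m n)"
          by (rule mult_left_mono) simp
        moreover have "ennreal (m n * (1/2) ^ Suc n) * ennreal (1 / m n) = ennreal ((1/2) ^ Suc n)"
          using E(3)[of n] by (subst ennreal_mult[symmetric]) auto
        moreover have "ennreal (m n * (1/2) ^ Suc n) * ennreal (2 ^ Suc n) = ennreal (m n)"
          using E(3)[of n] by (subst ennreal_mult[symmetric]) (auto simp: power_one_over)
        ultimately have "ennreal (m n) * \<Phi> (ennreal t) \<le> ennreal ((1/2) ^ Suc n)"
          by (simp only: mult.assoc[symmetric])
        then show ?thesis
          using True E(2) by (simp add: D_def mult.commute)
      qed (simp add: D_def)
    qed
    also have "\<dots> = ennreal (\<Sum>n. (1/2) ^ Suc n)"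
      by (rule suminf_ennreal2) (use power_half_series in \<open>auto simp: sums_iff\<close>)
    also have "\<dots> = 1" using power_half_series by (simp add: sums_iff)
    finally show ?thesis .
  qed
  \<comment> \<open>Where \<open>h\<close> is infinite, \<open>f\<close> is \<open>0\<close>. This
    only shrinks level sets, and it can spoil the lower bound on \<open>E n\<close> only on a set
    shown below to be null.\<close>
  define f where "f x = enn2real (h x)" for x
  have f: "f \<in> borel_measurable M" unfolding f_def by measurable
  have "weak_orlicz_admissible M \<Phi> f 1"
    unfolding weak_orlicz_admissible_def
  proof (intro conjI allI impI)
    fix t :: real assume t: "0 < t"
    have "{x \<in> space M. 1 * t < norm (f x)} \<subseteq> {x \<in> space M. ennreal t < h x}"
    proof safe
      fix x assume "1 * t < norm (f x)"
      then show "ennreal t < h x"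
        using t by (cases "h x") (auto simp: f_def ennreal_less_iff)
    qed
    then have "\<Phi> (ennreal t) * emeasure M {x \<in> space M. 1 * t < norm (f x)}
        \<le> \<Phi> (ennreal t) * emeasure M {x \<in> space M. ennreal t < h x}"
      by (intro mult_left_mono emeasure_mono) auto
    with bound[OF t] show "\<Phi> (ennreal t) * emeasure M {x \<in> space M. 1 * t < norm (f x)} \<le> 1"
      by (rule order_trans[rotated])
  qed simp
  moreover have "AE x in M. h x \<noteq> \<infinity>"
  proof -
    let ?N = "{x \<in> space M. h x = \<infinity>}"
    \<comment> \<open>The set \<open>?N\<close> lies in every level set of \<open>h\<close>, and
      \<open>\<Phi>\<close> exceeds any given \<open>u\<close> at a finite level, so
      \<open>bound\<close> applies with arbitrarily large factors.\<close>
    have "\<infinity> * emeasure M ?N \<le> 1"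
    proof (rule ennreal_mult_le_oneI)
      fix u :: real assume u: "0 < u"
      obtain v where v: "0 < v" "young_inverse \<Phi> (ennreal u) = ennreal v"
        using young_inverse_real[OF \<Phi> u] .
      have "ennreal u \<le> \<Phi> (ennreal (v + 1))"
        using v by (intro less_imp_le young_inverse_less[OF \<Phi>]) (auto intro: ennreal_lessI)
      moreover have "emeasure M ?N \<le> emeasure M {x \<in> space M. ennreal (v + 1) < h x}"
        by (intro emeasure_mono) auto
      ultimately have "ennreal u * emeasure M ?N
          \<le> \<Phi> (ennreal (v + 1)) * emeasure M {x \<in> space M. ennreal (v + 1) < h x}"
        by (intro mult_mono) auto
      also have "\<dots> \<le> 1" using v by (intro bound) simp
      finally show "ennreal u * emeasure M ?N \<le> 1" .
    qed
    then have "emeasure M ?N = 0"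
      by (auto simp: ennreal_top_mult top_unique split: if_splits)
    then show ?thesis by (intro AE_I[of _ _ ?N]) auto
  qed
  then have "AE x in M. x \<in> E n \<longrightarrow> y n / 2 ^ Suc n \<le> f x" for n
  proof eventually_elim
    case (elim x)
    show ?case
    proof
      assume "x \<in> E n"
      then have "ennreal (z n) \<le> h x"
        unfolding h_def by (intro SUP_upper2[of n]) auto
      with elim z[of n] show "y n / 2 ^ Suc n \<le> f x"
        by (cases "h x") (auto simp: f_def z_def)
    qed
  qed
  ultimately show thesis using that f by blast
qed

text \<open>Of the growth \<open>4 ^ Suc n\<close> one factor \<open>2 ^ Suc n\<close> pays for the
  lowered heights in the gliding hump; the other outgrows every constant \<open>r\<close> that could
  be admissible for the product.\<close>

lemma PWM_subset_weak_orlicz: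
  assumes \<sigma>: "sigma_finite_measure M"
    and \<Phi>: "young_function \<Phi>1" "young_function \<Phi>2" "young_function \<Phi>3"
    and C: "0 < C" "\<And>u. 0 < u \<Longrightarrow> u < \<infinity> \<Longrightarrow>
      ennreal (1 / C) * young_inverse \<Phi>2 u \<le> young_inverse \<Phi>1 u * young_inverse \<Phi>3 u"
  shows "PWM M (weak_orlicz M \<Phi>1) (weak_orlicz M \<Phi>2)
    \<subseteq> (weak_orlicz M \<Phi>3 :: ('x \<Rightarrow> 'a::{real_normed_field, euclidean_space}) set)"
proof
  fix g :: "'x \<Rightarrow> 'a" assume "g \<in> PWM M (weak_orlicz M \<Phi>1) (weak_orlicz M \<Phi>2)"
  then have g[measurable]: "g \<in> borel_measurable M"
    and mult: "\<And>f. f \<in> weak_orlicz M \<Phi>1 \<Longrightarrow> (\<lambda>x. f x * g x) \<in> weak_orlicz M \<Phi>2"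
    by (auto simp: PWM_def)
  show "g \<in> weak_orlicz M \<Phi>3"
  proof (rule ccontr)
    assume "g \<notin> weak_orlicz M \<Phi>3"
    then have not: "\<not> weak_orlicz_admissible M \<Phi>3 g l" for l
      using g by (auto simp: weak_orlicz_iff[OF \<Phi>(3)])
    have "\<exists>E m a b. E \<in> sets M \<and> 0 < m \<and> emeasure M E = ennreal m \<and>
        0 < a \<and> young_inverse \<Phi>1 (ennreal (1/m)) = ennreal a \<and>
        0 < b \<and> young_inverse \<Phi>2 (ennreal (1/m)) = ennreal b \<and>
        (\<forall>x\<in>E. 4 ^ Suc n * b < a * norm (g x))" for n
    proof -
      have l: "0 < C * 4 ^ Suc n" using C by simp
      from not_admissible_finite_witness[OF \<sigma> g l not]
      obtain E m t where E: "E \<in> sets M" "0 < m" "emeasure M E = ennreal m" and t: "0 < t"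
        "ennreal (1/m) < \<Phi>3 (ennreal t)" "\<forall>x\<in>E. C * 4 ^ Suc n * t < norm (g x)" .
      have m: "0 < 1/m" using E by simp
      obtain a where a: "0 < a" "young_inverse \<Phi>1 (ennreal (1/m)) = ennreal a"
        using young_inverse_real[OF \<Phi>(1) m] .
      obtain b where b: "0 < b" "young_inverse \<Phi>2 (ennreal (1/m)) = ennreal b"
        using young_inverse_real[OF \<Phi>(2) m] .
      have "ennreal (1/C * b) \<le> ennreal a * young_inverse \<Phi>3 (ennreal (1/m))"
        using C(2)[of "ennreal (1/m)"] m a b C(1) by (subst ennreal_mult) auto
      also have "\<dots> \<le> ennreal (a * t)"
        using young_inverse_le[of "1/m" \<Phi>3 "ennreal t"] t a
        by (subst ennreal_mult) (auto intro: mult_left_mono)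
      finally have bt: "b \<le> C * (a * t)"
        using a t C by (simp add: field_simps)
      have "4 ^ Suc n * b < a * norm (g x)" if "x \<in> E" for x
      proof -
        have "4 ^ Suc n * b \<le> 4 ^ Suc n * (C * (a * t))"
          using bt by (intro mult_left_mono) auto
        also have "\<dots> = a * (C * 4 ^ Suc n * t)" by simp
        also have "\<dots> < a * norm (g x)"
          using t(3) that a by (intro mult_strict_left_mono) auto
        finally show ?thesis .
      qed
      with E a b show ?thesis by blast
    qed
    then obtain E m a b where
      E: "\<And>n. E n \<in> sets M" "\<And>n. 0 < m n" "\<And>n. emeasure M (E n) = ennreal (m n)"
      and a: "\<And>n. 0 < a n" "\<And>n. young_inverse \<Phi>1 (ennreal (1 / m n)) = ennreal (a n)"
      and b: "\<And>n. 0 < b n" "\<And>n. young_inverse \<Phi>2 (ennreal (1 / m n)) = ennreal (b n)"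
      and gE: "\<And>n x. x \<in> E n \<Longrightarrow> 4 ^ Suc n * b n < a n * norm (g x)"
      by metis
    obtain f :: "'x \<Rightarrow> real" where f[measurable]: "f \<in> borel_measurable M"
      and adm: "weak_orlicz_admissible M \<Phi>1 f 1"
      and fE: "\<forall>n. AE x in M. x \<in> E n \<longrightarrow> a n / 2 ^ Suc n \<le> f x"
      using weak_orlicz_gliding_hump[OF \<Phi>(1) E(1,3,2) a(2,1)] .
    \<comment> \<open>Admissibility depends only on norms, and \<open>of_real\<close> preserves
      absolute values.\<close>
    have "weak_orlicz_admissible M \<Phi>1 (\<lambda>x. of_real (f x) :: 'a) 1"
      using adm by (simp add: weak_orlicz_admissible_def)
    then have "(\<lambda>x. of_real (f x) :: 'a) \<in> weak_orlicz M \<Phi>1"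
      unfolding weak_orlicz_iff[OF \<Phi>(1)] by auto
    from mult[OF this] obtain r where
      r: "weak_orlicz_admissible M \<Phi>2 (\<lambda>x. of_real (f x) * g x) r"
      unfolding weak_orlicz_iff[OF \<Phi>(2)] by blast
    then have "0 < r" by (simp add: weak_orlicz_admissible_def)
    obtain n where n: "r < 2 ^ n" using real_arch_pow[of 2 r] by auto
    have "r < 2 ^ Suc n" using n by (simp add: order_less_le_trans)
    \<comment> \<open>Here \<open>r * s = 2 ^ Suc n * b n\<close>, a level exceeded by the product
      almost everywhere on \<open>E n\<close>, while \<open>r < 2 ^ Suc n\<close> gives
      \<open>s > b n\<close> and so \<open>\<Phi>2\<close> above \<open>1 / m n\<close>.\<close>
    define s where "s = 2 ^ Suc n * b n / r"
    have "b n < s" using \<open>r < 2 ^ Suc n\<close> \<open>0 < r\<close> b(1)[of n] by (simp add: s_def field_simps)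
    then have s: "ennreal (1 / m n) < \<Phi>2 (ennreal s)" "0 < s"
      using b[of n] by (auto intro!: young_inverse_less[OF \<Phi>(2)] ennreal_lessI)
    let ?D = "{x \<in> space M. r * s < norm (of_real (f x) * g x)}"
    have "AE x in M. x \<in> E n \<longrightarrow> x \<in> ?D"
      using fE[rule_format, of n] AE_space
    proof eventually_elim
      case (elim x)
      show ?case
      proof
        assume x: "x \<in> E n"
        have "(4::real) ^ Suc n = 2 ^ Suc n * 2 ^ Suc n"
          by (subst power_mult_distrib[symmetric]) simp
        then have "r * s = 4 ^ Suc n * b n / 2 ^ Suc n"
          using \<open>0 < r\<close> by (simp add: s_def del: power_Suc)
        also have "\<dots> < a n * norm (g x) / 2 ^ Suc n"
          using gE[OF x] by (intro divide_strict_right_mono) auto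
        also have "\<dots> = a n / 2 ^ Suc n * norm (g x)" by simp
        also have "\<dots> \<le> \<bar>f x\<bar> * norm (g x)"
          using elim x by (intro mult_right_mono) auto
        finally show "x \<in> ?D" using elim by (simp add: norm_mult)
      qed
    qed
    then have "emeasure M (E n) \<le> emeasure M ?D"
      by (intro emeasure_mono_AE) auto
    then have "\<Phi>2 (ennreal s) * emeasure M (E n) \<le> \<Phi>2 (ennreal s) * emeasure M ?D"
      by (intro mult_left_mono) auto
    also have "\<dots> \<le> 1" using r s(2) by (simp add: weak_orlicz_admissible_def)
    finally have "\<Phi>2 (ennreal s) * ennreal (m n) \<le> 1" by (simp add: E)
    moreover have "ennreal (1 / m n) * ennreal (m n) < \<Phi>2 (ennreal s) * ennreal (m n)"
      using s E(2)[of n] by (intro ennreal_mult_strict_right_mono) auto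
    moreover have "ennreal (1 / m n) * ennreal (m n) = 1"
      using E(2)[of n] by (simp add: ennreal_mult[symmetric])
    ultimately show False by simp
  qed
qed

section \<open>Upper norm bound and conclusion\<close>

lemma PWM_norm_le:
  fixes g :: "'x \<Rightarrow> 'a::{real_normed_field, euclidean_space}"
  assumes \<Phi>: "young_function \<Phi>1" "young_function \<Phi>2" "young_function \<Phi>3"
    and C: "0 < C" "\<And>u. 0 < u \<Longrightarrow> u < \<infinity> \<Longrightarrow>
      young_inverse \<Phi>1 u * young_inverse \<Phi>3 u \<le> ennreal C * young_inverse \<Phi>2 u"
    and g: "g \<in> weak_orlicz M \<Phi>3"
  shows "PWM_norm (weak_orlicz M \<Phi>1) (weak_orlicz_norm M \<Phi>1) (weak_orlicz_norm M \<Phi>2) g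
    \<le> ennreal (4 * C) * weak_orlicz_norm M \<Phi>3 g"
proof -
  have gm: "g \<in> borel_measurable M" using g by (simp add: weak_orlicz_def)
  obtain B where B: "0 \<le> B" "weak_orlicz_norm M \<Phi>3 g = ennreal B"
    using weak_orlicz_norm_finite[OF \<Phi>(3) g] by (cases "weak_orlicz_norm M \<Phi>3 g") auto
  have "weak_orlicz_norm M \<Phi>2 (\<lambda>x. f x * g x) \<le> ennreal (4 * C * B) * weak_orlicz_norm M \<Phi>1 f"
    if f: "f \<in> weak_orlicz M \<Phi>1" for f
  proof -
    have fm: "f \<in> borel_measurable M" using f by (simp add: weak_orlicz_def)
    obtain A where A: "0 \<le> A" "weak_orlicz_norm M \<Phi>1 f = ennreal A"
      using weak_orlicz_norm_finite[OF \<Phi>(1) f] by (cases "weak_orlicz_norm M \<Phi>1 f") auto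
    \<comment> \<open>Only constants strictly above the quasi-norms are known to be admissible. The
      shift by \<open>e\<close> also covers zero quasi-norms, as admissible constants are
      positive.\<close>
    have "weak_orlicz_norm M \<Phi>2 (\<lambda>x. f x * g x) \<le> ennreal (4 * C * (A + e) * (B + e))"
      if "0 < e" for e
      using that A B
      by (intro weak_orlicz_norm_le weak_orlicz_admissible_mult[OF \<Phi> C fm gm]
          weak_orlicz_admissible_of_norm_less fm gm) (auto intro: ennreal_lessI)
    then have "eventually (\<lambda>e. weak_orlicz_norm M \<Phi>2 (\<lambda>x. f x * g x)
        \<le> ennreal (4 * C * (A + e) * (B + e))) (at_right 0)"
      by (intro eventually_at_rightI[of 0 1]) auto
    moreover have "((\<lambda>e. ennreal (4 * C * (A + e) * (B + e)))
        \<longlongrightarrow> ennreal (4 * C * A * B)) (at_right 0)"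
      by (rule tendsto_eq_intros refl | simp)+
    ultimately have "weak_orlicz_norm M \<Phi>2 (\<lambda>x. f x * g x) \<le> ennreal (4 * C * A * B)"
      by (intro tendsto_lowerbound[of _ _ "at_right 0"]) auto
    then show ?thesis using A B C by (simp add: ennreal_mult[symmetric] mult_ac)
  qed
  then have "PWM_norm (weak_orlicz M \<Phi>1) (weak_orlicz_norm M \<Phi>1) (weak_orlicz_norm M \<Phi>2) g
      \<le> ennreal (4 * C * B)"
    unfolding PWM_norm_def using B C by (intro INF_lower) auto
  then show ?thesis using B C by (simp add: ennreal_mult)
qed

theorem corollary3p3:
  fixes M :: "'x measure"
    and \<Phi>1 \<Phi>2 \<Phi>3 :: "ennreal \<Rightarrow> ennreal"
    and C1 C2 :: real
  assumes "complete_measure M" and "sigma_finite_measure M"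
    and "young_function \<Phi>1" and "young_function \<Phi>2" and "young_function \<Phi>3"
    and "C1 > 0" and "C2 > 0"
    and "\<And>u. 0 < u \<Longrightarrow> u < \<infinity> \<Longrightarrow>
           ennreal (1 / C1) * young_inverse \<Phi>2 u \<le> young_inverse \<Phi>1 u * young_inverse \<Phi>3 u \<and>
           young_inverse \<Phi>1 u * young_inverse \<Phi>3 u \<le> ennreal C2 * young_inverse \<Phi>2 u"
  shows "PWM M (weak_orlicz M \<Phi>1) (weak_orlicz M \<Phi>2)
           = (weak_orlicz M \<Phi>3 :: ('x \<Rightarrow> 'a::{real_normed_field, euclidean_space}) set)
       \<and> (\<forall>g \<in> (weak_orlicz M \<Phi>3 :: ('x \<Rightarrow> 'a) set).
            ennreal (1 / C1) * weak_orlicz_norm M \<Phi>3 g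
              \<le> PWM_norm (weak_orlicz M \<Phi>1) (weak_orlicz_norm M \<Phi>1) (weak_orlicz_norm M \<Phi>2) g
          \<and> PWM_norm (weak_orlicz M \<Phi>1) (weak_orlicz_norm M \<Phi>1) (weak_orlicz_norm M \<Phi>2) g
              \<le> ennreal (4 * C2) * weak_orlicz_norm M \<Phi>3 g)"
proof (intro conjI ballI equalityI)
  note \<Phi> = assms(3-5)
  have lower: "\<And>u. 0 < u \<Longrightarrow> u < \<infinity> \<Longrightarrow>
      ennreal (1 / C1) * young_inverse \<Phi>2 u \<le> young_inverse \<Phi>1 u * young_inverse \<Phi>3 u"
    and upper: "\<And>u. 0 < u \<Longrightarrow> u < \<infinity> \<Longrightarrow>
      young_inverse \<Phi>1 u * young_inverse \<Phi>3 u \<le> ennreal C2 * young_inverse \<Phi>2 u"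
    using assms(8) by blast+
  show "PWM M (weak_orlicz M \<Phi>1) (weak_orlicz M \<Phi>2) \<subseteq> (weak_orlicz M \<Phi>3 :: ('x \<Rightarrow> 'a) set)"
    by (rule PWM_subset_weak_orlicz[OF assms(2) \<Phi> assms(6)]) (rule lower)
  show "(weak_orlicz M \<Phi>3 :: ('x \<Rightarrow> 'a) set) \<subseteq> PWM M (weak_orlicz M \<Phi>1) (weak_orlicz M \<Phi>2)"
  proof
    fix g :: "'x \<Rightarrow> 'a" assume "g \<in> weak_orlicz M \<Phi>3"
    then obtain s where g: "g \<in> borel_measurable M" "weak_orlicz_admissible M \<Phi>3 g s"
      by (auto simp: weak_orlicz_iff[OF \<Phi>(3)])
    have "(\<lambda>x. f x * g x) \<in> weak_orlicz M \<Phi>2" if f: "f \<in> weak_orlicz M \<Phi>1" for f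
    proof -
      from f obtain r where f: "f \<in> borel_measurable M" "weak_orlicz_admissible M \<Phi>1 f r"
        by (auto simp: weak_orlicz_iff[OF \<Phi>(1)])
      have "weak_orlicz_admissible M \<Phi>2 (\<lambda>x. f x * g x) (4 * C2 * r * s)"
        by (rule weak_orlicz_admissible_mult[OF \<Phi> assms(7) _ f(1) g(1) f(2) g(2)]) (rule upper)
      moreover have "(\<lambda>x. f x * g x) \<in> borel_measurable M"
        using f g by measurable
      ultimately show ?thesis
        unfolding weak_orlicz_iff[OF \<Phi>(2)] by blast
    qed
    with g show "g \<in> PWM M (weak_orlicz M \<Phi>1) (weak_orlicz M \<Phi>2)"
      by (simp add: PWM_def)
  qed
  fix g :: "'x \<Rightarrow> 'a" assume g: "g \<in> weak_orlicz M \<Phi>3"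
  then have gm: "g \<in> borel_measurable M" by (simp add: weak_orlicz_def)
  show "PWM_norm (weak_orlicz M \<Phi>1) (weak_orlicz_norm M \<Phi>1) (weak_orlicz_norm M \<Phi>2) g
      \<le> ennreal (4 * C2) * weak_orlicz_norm M \<Phi>3 g"
    by (rule PWM_norm_le[OF \<Phi> assms(7) _ g]) (rule upper)
  show "ennreal (1 / C1) * weak_orlicz_norm M \<Phi>3 g
      \<le> PWM_norm (weak_orlicz M \<Phi>1) (weak_orlicz_norm M \<Phi>1) (weak_orlicz_norm M \<Phi>2) g"
    unfolding PWM_norm_def
  proof (rule INF_greatest, clarify)
    \<comment> \<open>Every \<open>K\<close> competing in the infimum is bounded from below
      separately, so no bound for the multiplier has to be exhibited at this point.\<close>
    fix K :: real
    assume K: "0 \<le> K" "\<forall>f\<in>weak_orlicz M \<Phi>1.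
      weak_orlicz_norm M \<Phi>2 (\<lambda>x. f x * g x) \<le> ennreal K * weak_orlicz_norm M \<Phi>1 f"
    have "weak_orlicz_norm M \<Phi>3 g \<le> ennreal (C1 * K)"
      by (rule weak_orlicz_norm_le_of_multiplier_bound[OF assms(2) \<Phi> assms(6) _ gm K(1)])
        (rule lower K(2)[rule_format]; assumption)+
    then have "ennreal (1 / C1) * weak_orlicz_norm M \<Phi>3 g \<le> ennreal (1 / C1) * ennreal (C1 * K)"
      by (rule mult_left_mono) simp
    also have "\<dots> = ennreal K" using assms(6) K(1) by (subst ennreal_mult[symmetric]) auto
    finally show "ennreal (1 / C1) * weak_orlicz_norm M \<Phi>3 g \<le> ennreal K" .
  qed
qed

end
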